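(* Let $N\cong\mathbb{Z}^3$ and let $P$ be a minimal Fano polytope in $N_\mathbb{R}$ which contains two triangles $T_1,T_2$, whose vertices are vertices of $P$, lying in distinct two-dimensional linear subspaces $L_1\ne L_2$, such that $T_1$ is equivalent (under an isomorphism of lattices $\mathbb{Z}^2\to N\cap L_1$) to $\mathrm{conv}\{(1,0),(0,1),(-1,-1)\}$ and $T_2$ is equivalent (under an isomorphism $\mathbb{Z}^2\to N\cap L_2$) to $\mathrm{conv}\{(1,0),(0,1),(-2,-1)\}$. Then, up to the action of $GL(3,\mathbb{Z})$, $P$ is the convex hull of the columns of $$\begin{pmatrix}1&0&0&-2&-1\\0&1&0&-1&0\\0&0&1&0&-1\end{pmatrix}.$$
   Context: A Fano polytope is a three-dimensional convex polytope $P\subset N_\mathbb{R}$ with vertices in $N$ such that the origin is the only lattice point in the interior of $P$. It is minimal if, for every vertex $\rho$ of $P$, the polytope $\mathrm{conv}((P\cap N)\setminus\{\rho\})$ is not a Fano polytope. Polytopes are identified up to $GL(3,\mathbb{Z})$ (after choosing a basis of $N$). *)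

theory Defs
  imports "HOL-Analysis.Analysis"
begin

text \<open>The lattice N = Z^3 inside N_R = R^3, and Z^2 inside R^2.\<close>
definition lattice3 :: "(real^3) set" where
  "lattice3 = {x. \<forall>i. x $ i \<in> \<int>}"

definition lattice2 :: "(real^2) set" where
  "lattice2 = {x. \<forall>i. x $ i \<in> \<int>}"

text \<open>A (three-dimensional) Fano polytope: the convex hull of finitely many lattice
  points such that the origin is the only lattice point in its interior
  (this forces full dimension).\<close>
definition fano_polytope :: "(real^3) set \<Rightarrow> bool" where
  "fano_polytope P \<longleftrightarrow>
     (\<exists>V. finite V \<and> V \<subseteq> lattice3 \<and> P = convex hull V) \<and>
     interior P \<inter> lattice3 = {0}"

text \<open>Vertices of a polytope = its extreme points.\<close>
definition vertices :: "(real^3) set \<Rightarrow> (real^3) set" where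
  "vertices P = {v. v extreme_point_of P}"

definition minimal_fano :: "(real^3) set \<Rightarrow> bool" where
  "minimal_fano P \<longleftrightarrow> fano_polytope P \<and>
     (\<forall>\<rho>\<in>vertices P. \<not> fano_polytope (convex hull ((P \<inter> lattice3) - {\<rho>})))"

text \<open>Lattice isomorphism Z^2 \<rightarrow> N \<inter> L (restriction of an injective linear map).\<close>
definition lattice_iso_onto :: "(real^2 \<Rightarrow> real^3) \<Rightarrow> (real^3) set \<Rightarrow> bool" where
  "lattice_iso_onto f L \<longleftrightarrow> linear f \<and> inj f \<and> f ` lattice2 = lattice3 \<inter> L"

text \<open>GL(3,Z): integer matrices with determinant \<plusminus>1.\<close>
definition GL3Z :: "(real^3^3) set" where
  "GL3Z = {A. (\<forall>i j. A $ i $ j \<in> \<int>) \<and> \<bar>det A\<bar> = 1}"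

end

theory Submission
  imports Defs "HOL-Analysis.Cross3"
begin

text \<open>Write the triangles as \<open>a, b, -a-b\<close> and \<open>d, e, -2d-e\<close>. Minimality is used in one form
  only: if the origin is interior to the hull of lattice points of \<open>P\<close> avoiding some vertex, that
  vertex could be removed. The first triangle surrounds the origin inside its plane, so any two
  lattice points of \<open>P\<close> on opposite sides of that plane already put the origin into the interior.
  Since \<open>-2d-e\<close> is a negative combination of \<open>d, e\<close>, two vertices of the second triangle lie on
  opposite sides of the first plane; hence \<open>P\<close> is the hull of the six points. The same argument
  with the roles exchanged forces the triangles to share a vertex, and that vertex is \<open>d\<close>: otherwise
  \<open>d\<close> and \<open>-d\<close> (the midpoint of \<open>e\<close> and \<open>-2d-e\<close>) straddle the first plane and a vertex becomes
  superfluous. Finally \<open>d, e, q\<close> (with \<open>q\<close> the next vertex of the first triangle) is a lattice basis: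
  if \<open>e\<close> had height \<open>k \<ge> 2\<close> over the plane, a lattice point of height \<open>1\<close> would lie in \<open>P\<close>
  strictly between that plane and \<open>e\<close>, again making \<open>e\<close> superfluous.\<close>

section \<open>Planes in \<open>\<real>\<^sup>3\<close>\<close>

lemma span_pair: "x \<in> span {p, q} \<longleftrightarrow> (\<exists>s t. x = s *\<^sub>R p + t *\<^sub>R q)"
proof -
  have "x - s *\<^sub>R p = t *\<^sub>R q \<longleftrightarrow> x = s *\<^sub>R p + t *\<^sub>R q" for s t
    by (auto simp: algebra_simps)
  then show ?thesis
    unfolding span_breakdown_eq span_singleton by (metis (mono_tags, lifting) image_iff UNIV_I)
qed

lemma independent_pair:
  fixes p q :: "'a::real_vector"
  assumes indep: "\<And>s t. s *\<^sub>R p + t *\<^sub>R q = 0 \<Longrightarrow> s = 0 \<and> t = 0"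
  shows "independent {p, q}" "p \<noteq> q"
proof -
  have "q \<noteq> 0" using indep[of 0 1] by auto
  moreover have "p \<notin> span {q}"
  proof
    assume "p \<in> span {q}"
    then obtain k where "p = k *\<^sub>R q" by (auto simp: span_singleton)
    then show False using indep[of 1 "-k"] by simp
  qed
  ultimately show "independent {p, q}"
    by (simp add: independent_insert)
  show "p \<noteq> q" using indep[of 1 "-1"] by auto
qed

lemma span_pair_eq:
  fixes a b d e :: "'a::euclidean_space"
  assumes "\<And>s t. s *\<^sub>R a + t *\<^sub>R b = 0 \<Longrightarrow> s = 0 \<and> t = 0"
    and "\<And>s t. s *\<^sub>R d + t *\<^sub>R e = 0 \<Longrightarrow> s = 0 \<and> t = 0"
    and "a \<in> span {d, e}" "b \<in> span {d, e}"
  shows "span {a, b} = span {d, e}"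
proof (rule subspace_dim_equal)
  show "span {a, b} \<subseteq> span {d, e}" using assms(3,4) by (simp add: span_minimal)
  show "dim (span {d, e}) \<le> dim (span {a, b})"
    using independent_pair[of a b] independent_pair[of d e] assms(1,2)
    by (simp add: dim_eq_card_independent)
qed auto

lemma hyperplane_eq_span_pair:
  fixes n p q :: "real^3"
  assumes indep: "\<And>s t. s *\<^sub>R p + t *\<^sub>R q = 0 \<Longrightarrow> s = 0 \<and> t = 0"
    and "n \<noteq> 0" "n \<bullet> p = 0" "n \<bullet> q = 0"
  shows "{x. n \<bullet> x = 0} = span {p, q}"
proof (rule subspace_dim_equal[symmetric])
  show "span {p, q} \<subseteq> {x. n \<bullet> x = 0}"
    using assms by (intro span_minimal) (auto simp: subspace_hyperplane)
  have "dim (span {p, q}) = 2"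
    using independent_pair[of p q] indep by (simp add: dim_eq_card_independent)
  then show "dim {x. n \<bullet> x = 0} \<le> dim (span {p, q})"
    using \<open>n \<noteq> 0\<close> by (simp add: dim_hyperplane)
qed (auto simp: subspace_hyperplane)

lemma cross3_nonzero:
  fixes p q :: "real^3"
  assumes indep: "\<And>s t. s *\<^sub>R p + t *\<^sub>R q = 0 \<Longrightarrow> s = 0 \<and> t = 0"
  shows "cross3 p q \<noteq> 0"
proof
  assume "cross3 p q = 0"
  then have "(q \<bullet> q) *\<^sub>R p + (- (q \<bullet> p)) *\<^sub>R q = 0"
    using Lagrange[of q p q] by simp
  then have "q \<bullet> q = 0" using indep by blast
  then have "q = 0" by simp
  then show False using indep[of 0 1] by simp
qed

lemma cross3_eq_0_iff_in_span:
  fixes p q x :: "real^3"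
  assumes indep: "\<And>s t. s *\<^sub>R p + t *\<^sub>R q = 0 \<Longrightarrow> s = 0 \<and> t = 0"
  shows "cross3 p q \<bullet> x = 0 \<longleftrightarrow> x \<in> span {p, q}"
  using hyperplane_eq_span_pair[of p q "cross3 p q", OF indep] cross3_nonzero[of p q] indep
  by (auto simp: dot_cross_self)

lemma triangle_vertices_distinct:
  fixes a b :: "'a::real_vector"
  assumes indep: "\<And>s t. s *\<^sub>R a + t *\<^sub>R b = 0 \<Longrightarrow> s = 0 \<and> t = 0"
  shows "a \<noteq> b" "a \<noteq> -a-b" "b \<noteq> -a-b"
proof -
  have "1 *\<^sub>R a + (-1) *\<^sub>R b \<noteq> 0" "2 *\<^sub>R a + 1 *\<^sub>R b \<noteq> 0" "1 *\<^sub>R a + 2 *\<^sub>R b \<noteq> 0"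
    using indep[of 1 "-1"] indep[of 2 1] indep[of 1 2] by auto
  moreover have "1 *\<^sub>R a + (-1) *\<^sub>R b = a - b" "2 *\<^sub>R a + 1 *\<^sub>R b = a - (-a-b)"
    "1 *\<^sub>R a + 2 *\<^sub>R b = b - (-a-b)"
    by (simp_all add: algebra_simps scaleR_2)
  ultimately show "a \<noteq> b" "a \<noteq> -a-b" "b \<noteq> -a-b" by (simp_all only: right_minus_eq simp_thms)
qed

lemma span_rotate: "span {b, -a-b} = span {a, b}"
proof -
  have "s *\<^sub>R b + t *\<^sub>R (-a-b) = (-t) *\<^sub>R a + (s - t) *\<^sub>R b" for s t
    by (simp add: algebra_simps)
  moreover have "s *\<^sub>R a + t *\<^sub>R b = (t - s) *\<^sub>R b + (-s) *\<^sub>R (-a-b)" for s t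
    by (simp add: algebra_simps)
  ultimately show ?thesis unfolding set_eq_iff span_pair by metis
qed

lemma linear_coords2:
  fixes f :: "real^2 \<Rightarrow> 'a::real_vector"
  assumes "linear f"
  shows "f x = (x$1) *\<^sub>R f (vector [1, 0]) + (x$2) *\<^sub>R f (vector [0, 1])"
proof -
  have "x = (x$1) *\<^sub>R (vector [1, 0] :: real^2) + (x$2) *\<^sub>R vector [0, 1]"
    by (simp add: vec_eq_iff forall_2)
  then have "f x = f ((x$1) *\<^sub>R (vector [1, 0] :: real^2) + (x$2) *\<^sub>R vector [0, 1])"
    by (rule arg_cong)
  then show ?thesis using assms by (simp add: linear_add linear_scale)
qed

section \<open>Cones and interior points\<close>

lemma convex_scale_origin: "convex C \<Longrightarrow> 0 \<in> C \<Longrightarrow> x \<in> C \<Longrightarrow> 0 \<le> u \<Longrightarrow> u \<le> 1 \<Longrightarrow> u *\<^sub>R x \<in> C"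
  using convexD[of C x 0 u "1-u"] by simp

lemma mem_convex_hull_quadrangle:
  fixes p q :: "'a::real_vector"
  assumes "s + t \<le> 1" "t - s \<le> 1" "-1 \<le> s" "s - 2 * t \<le> 1"
  shows "s *\<^sub>R p + t *\<^sub>R q \<in> convex hull {p, q, -p, -p-q}"
proof (cases "t \<ge> 0")
  case True
  have "((1 - t + s) / 2) *\<^sub>R p + t *\<^sub>R q + ((1 - t - s) / 2) *\<^sub>R (-p) \<in> convex hull {p, q, -p}"
    unfolding convex_hull_3
    by (rule CollectI, rule exI[of _ "(1 - t + s) / 2"], rule exI[of _ t], rule exI[of _ "(1 - t - s) / 2"])
      (use assms True in \<open>auto simp: field_simps\<close>)
  moreover have "((1 - t + s) / 2) *\<^sub>R p + t *\<^sub>R q + ((1 - t - s) / 2) *\<^sub>R (-p)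
      = ((1 - t + s) / 2 - (1 - t - s) / 2) *\<^sub>R p + t *\<^sub>R q"
    by (simp add: algebra_simps)
  moreover have "(1 - t + s) / 2 - (1 - t - s) / 2 = s" by (simp add: field_simps)
  moreover have "convex hull {p, q, -p} \<subseteq> convex hull {p, q, -p, -p-q}" by (rule hull_mono) auto
  ultimately show ?thesis by (metis subsetD)
next
  case False
  have "((1 + s) / 2) *\<^sub>R p + ((1 + 2 * t - s) / 2) *\<^sub>R (-p) + (-t) *\<^sub>R (-p-q) \<in> convex hull {p, -p, -p-q}"
    unfolding convex_hull_3
    by (rule CollectI, rule exI[of _ "(1 + s) / 2"], rule exI[of _ "(1 + 2 * t - s) / 2"], rule exI[of _ "-t"])
      (use assms False in \<open>auto simp: field_simps\<close>)
  moreover have "((1 + s) / 2) *\<^sub>R p + ((1 + 2 * t - s) / 2) *\<^sub>R (-p) + (-t) *\<^sub>R (-p-q)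
      = ((1 + s) / 2 - (1 + 2 * t - s) / 2 + t) *\<^sub>R p + t *\<^sub>R q"
    by (simp add: algebra_simps)
  moreover have "(1 + s) / 2 - (1 + 2 * t - s) / 2 + t = s" by (simp add: field_simps)
  moreover have "convex hull {p, -p, -p-q} \<subseteq> convex hull {p, q, -p, -p-q}" by (rule hull_mono) auto
  ultimately show ?thesis by (metis subsetD)
qed

lemma span_subset_convex_cone:
  assumes K: "convex_cone K" and "S \<subseteq> K" "uminus ` S \<subseteq> K"
  shows "span S \<subseteq> K"
proof -
  have "subspace {x. x \<in> K \<and> -x \<in> K}"
  proof (rule subspaceI)
    fix c :: real and x assume "x \<in> {x. x \<in> K \<and> -x \<in> K}"
    then show "c *\<^sub>R x \<in> {x. x \<in> K \<and> -x \<in> K}"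
      using convex_cone_scaleR[OF K, of "\<bar>c\<bar>" x] convex_cone_scaleR[OF K, of "\<bar>c\<bar>" "-x"]
      by (cases "c \<ge> 0") auto
  next
    fix x y assume "x \<in> {x. x \<in> K \<and> -x \<in> K}" "y \<in> {x. x \<in> K \<and> -x \<in> K}"
    then show "x + y \<in> {x. x \<in> K \<and> -x \<in> K}"
      using convex_cone_add[OF K, of x y] convex_cone_add[OF K, of "-x" "-y"] by simp
  qed (simp add: convex_cone_contains_0[OF K])
  moreover have "S \<subseteq> {x. x \<in> K \<and> -x \<in> K}" using assms by auto
  ultimately show ?thesis by (metis (no_types, lifting) mem_Collect_eq span_minimal subset_iff)
qed

lemma origin_in_interior_if_cross_polytope:
  fixes C :: "'a::euclidean_space set"
  assumes C: "convex C" "0 \<in> C" and "d > 0" and dB: "\<And>b. b \<in> Basis \<Longrightarrow> d *\<^sub>R b \<in> C \<and> - (d *\<^sub>R b) \<in> C"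
  shows "0 \<in> interior C"
proof -
  define m where "m = real DIM('a)"
  have m: "m \<ge> 1" unfolding m_def by (simp add: Suc_le_eq)
  have "ball 0 (d / m) \<subseteq> C"
  proof
    fix x :: 'a assume "x \<in> ball 0 (d / m)"
    then have small: "\<bar>x \<bullet> b\<bar> < d / m" if "b \<in> Basis" for b
      using Basis_le_norm[OF that, of x] by auto
    have "(m * (x \<bullet> b)) *\<^sub>R b \<in> C" if b: "b \<in> Basis" for b
    proof -
      have "0 \<le> m * \<bar>x \<bullet> b\<bar> / d" "m * \<bar>x \<bullet> b\<bar> / d \<le> 1"
        using small[OF b] \<open>d > 0\<close> m by (auto simp: field_simps)
      then have "(m * \<bar>x \<bullet> b\<bar> / d) *\<^sub>R (if x \<bullet> b \<ge> 0 then d *\<^sub>R b else - (d *\<^sub>R b)) \<in> C"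
        using dB[OF b] by (intro convex_scale_origin[OF C]) auto
      then show ?thesis using \<open>d > 0\<close> by (auto split: if_splits)
    qed
    then have "(\<Sum>b\<in>Basis. (1 / m) *\<^sub>R ((m * (x \<bullet> b)) *\<^sub>R b)) \<in> C"
      using m by (intro convex_sum[OF finite_Basis C(1)]) (auto simp: m_def)
    also have "(\<Sum>b\<in>Basis. (1 / m) *\<^sub>R ((m * (x \<bullet> b)) *\<^sub>R b)) = x"
      using m by (simp add: euclidean_representation)
    finally show "x \<in> C" .
  qed
  moreover have "0 \<in> ball 0 (d / m)" using \<open>d > 0\<close> m by simp
  ultimately show ?thesis by (meson interior_maximal open_ball subsetD)
qed

lemma origin_in_interior_if_conic_hull_UNIV:
  fixes C :: "'a::euclidean_space set"
  assumes C: "convex C" "0 \<in> C" and K: "conic hull C = UNIV"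
  shows "0 \<in> interior C"
proof -
  define B where "B = Basis \<union> uminus ` (Basis :: 'a set)"
  have "\<exists>t>0. t *\<^sub>R v \<in> C" if "v \<in> B" for v
  proof -
    obtain c x where "v = c *\<^sub>R x" "0 \<le> c" "x \<in> C"
      using K unfolding conic_hull_explicit by blast
    moreover have "v \<noteq> 0" using that unfolding B_def by auto
    ultimately show ?thesis by (intro exI[of _ "1/c"]) auto
  qed
  then obtain \<delta> where \<delta>: "\<And>v. v \<in> B \<Longrightarrow> \<delta> v > 0 \<and> \<delta> v *\<^sub>R v \<in> C" by metis
  define d where "d = Min (\<delta> ` B)"
  have "finite B" "B \<noteq> {}" unfolding B_def by auto
  then have d: "d > 0" unfolding d_def using \<delta> by auto
  have dB: "d *\<^sub>R v \<in> C" if "v \<in> B" for v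
  proof -
    have "d \<le> \<delta> v" unfolding d_def using \<open>finite B\<close> that by auto
    then have "(d / \<delta> v) *\<^sub>R (\<delta> v *\<^sub>R v) \<in> C"
      using convex_scale_origin[OF C, of "\<delta> v *\<^sub>R v" "d / \<delta> v"] \<delta>[OF that] d by auto
    then show ?thesis using \<delta>[OF that] by simp
  qed
  have "d *\<^sub>R b \<in> C \<and> - (d *\<^sub>R b) \<in> C" if "b \<in> Basis" for b
    using dB[of b] dB[of "-b"] that unfolding B_def by auto
  then show ?thesis by (rule origin_in_interior_if_cross_polytope[OF C d])
qed

lemma convex_cone_eq_UNIV_if_straddles_plane:
  fixes K :: "(real^3) set" and p q y z n :: "real^3"
  assumes K: "convex_cone K" "span {p, q} \<subseteq> K" "y \<in> K" "z \<in> K"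
    and hyper: "{x. n \<bullet> x = 0} = span {p, q}" and y: "n \<bullet> y < 0" and z: "0 < n \<bullet> z"
  shows "K = UNIV"
proof -
  have "x \<in> K" for x
  proof (cases "n \<bullet> x \<ge> 0")
    case True
    define c where "c = (n \<bullet> x) / (n \<bullet> z)"
    have "x - c *\<^sub>R z \<in> span {p, q}" "c \<ge> 0"
      using z True unfolding hyper[symmetric] c_def by (auto simp: inner_diff_right)
    then have "(x - c *\<^sub>R z) + c *\<^sub>R z \<in> K"
      using K by (intro convex_cone_add[OF K(1)] convex_cone_scaleR[OF K(1)]) auto
    then show ?thesis by simp
  next
    case False
    define c where "c = (n \<bullet> x) / (n \<bullet> y)"
    have "x - c *\<^sub>R y \<in> span {p, q}" "c \<ge> 0"
      using y False unfolding hyper[symmetric] c_def by (auto simp: inner_diff_right divide_nonpos_neg)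
    then have "(x - c *\<^sub>R y) + c *\<^sub>R y \<in> K"
      using K by (intro convex_cone_add[OF K(1)] convex_cone_scaleR[OF K(1)]) auto
    then show ?thesis by simp
  qed
  then show ?thesis by blast
qed

text \<open>The cone over the hull contains the plane of the triangle, which surrounds the origin, and
  points on both sides of it; so it is everything.\<close>

lemma origin_in_interior_triangle_straddle:
  fixes p q y z n :: "real^3"
  assumes indep: "\<And>s t. s *\<^sub>R p + t *\<^sub>R q = 0 \<Longrightarrow> s = 0 \<and> t = 0"
    and "la > 0" "mu > 0"
    and n: "n \<bullet> p = 0" "n \<bullet> q = 0" and y: "n \<bullet> y < 0" and z: "0 < n \<bullet> z"
  shows "0 \<in> interior (convex hull {p, q, -(la *\<^sub>R p) - mu *\<^sub>R q, y, z})"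
proof -
  define r where "r = -(la *\<^sub>R p) - mu *\<^sub>R q"
  define C where "C = convex hull {p, q, r, y, z}"
  define K where "K = conic hull C"
  have C: "convex C" unfolding C_def by simp
  have K: "convex_cone K"
    unfolding K_def convex_cone_def using convex_conic_hull[OF C] conic_conic_hull
    by (auto simp: C_def conic_hull_eq_empty)
  have inK: "p \<in> K" "q \<in> K" "r \<in> K" "y \<in> K" "z \<in> K"
    unfolding K_def C_def by (auto intro: hull_inc)
  have "(la / (1 + la + mu)) *\<^sub>R p + (mu / (1 + la + mu)) *\<^sub>R q + (1 / (1 + la + mu)) *\<^sub>R r
          \<in> convex hull {p, q, r}"
    using \<open>la > 0\<close> \<open>mu > 0\<close> unfolding convex_hull_3
    by (intro CollectI exI conjI) (auto simp: add_divide_distrib[symmetric])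
  moreover have "convex hull {p, q, r} \<subseteq> C" unfolding C_def by (intro hull_mono) auto
  moreover have "(la / (1 + la + mu)) *\<^sub>R p + (mu / (1 + la + mu)) *\<^sub>R q + (1 / (1 + la + mu)) *\<^sub>R r = 0"
    unfolding r_def by (simp add: algebra_simps)
  ultimately have "0 \<in> C" by auto
  have "- p = (1 / la) *\<^sub>R (mu *\<^sub>R q + r)" "- q = (1 / mu) *\<^sub>R (la *\<^sub>R p + r)"
    unfolding r_def using \<open>la > 0\<close> \<open>mu > 0\<close> by (simp_all add: algebra_simps)
  then have "- p \<in> K" "- q \<in> K"
    using inK \<open>la > 0\<close> \<open>mu > 0\<close> by (auto intro!: convex_cone_scaleR[OF K] convex_cone_add[OF K])
  then have "span {p, q} \<subseteq> K"
    using inK by (intro span_subset_convex_cone[OF K]) auto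
  moreover have "{x. n \<bullet> x = 0} = span {p, q}"
    using hyperplane_eq_span_pair[of p q n, OF indep _ n] y by fastforce
  ultimately have "K = UNIV"
    using convex_cone_eq_UNIV_if_straddles_plane[OF K _ inK(4,5) _ y z] by blast
  then have "0 \<in> interior C"
    using origin_in_interior_if_conic_hull_UNIV[OF C \<open>0 \<in> C\<close>] unfolding K_def by blast
  then show ?thesis unfolding C_def r_def .
qed

lemma straddle_of_negative_combination:
  fixes n y1 y2 :: "real^3"
  assumes "ka > 0" "kb > 0" "\<not> (n \<bullet> y1 = 0 \<and> n \<bullet> y2 = 0)"
  obtains y z where "y \<in> {y1, y2, -(ka *\<^sub>R y1) - kb *\<^sub>R y2}" "z \<in> {y1, y2, -(ka *\<^sub>R y1) - kb *\<^sub>R y2}"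
    "n \<bullet> y < 0" "0 < n \<bullet> z"
proof -
  have v3: "n \<bullet> (-(ka *\<^sub>R y1) - kb *\<^sub>R y2) = - (ka * (n \<bullet> y1)) - kb * (n \<bullet> y2)"
    by (simp add: inner_diff_right)
  have "n \<bullet> y1 < 0 \<or> n \<bullet> y2 < 0 \<or> - (ka * (n \<bullet> y1)) - kb * (n \<bullet> y2) < 0"
       "0 < n \<bullet> y1 \<or> 0 < n \<bullet> y2 \<or> 0 < - (ka * (n \<bullet> y1)) - kb * (n \<bullet> y2)"
    using assms by (smt (verit, best) mult_minus_left zero_less_mult_iff)+
  then show ?thesis using that v3 by (metis insert_iff)
qed

section \<open>The lattice\<close>

lemma lattice3_iff: "x \<in> lattice3 \<longleftrightarrow> x$1 \<in> \<int> \<and> x$2 \<in> \<int> \<and> x$3 \<in> \<int>"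
  unfolding lattice3_def by (auto simp: forall_3)

lemma lattice3_add: "x \<in> lattice3 \<Longrightarrow> y \<in> lattice3 \<Longrightarrow> x + y \<in> lattice3"
  and lattice3_diff: "x \<in> lattice3 \<Longrightarrow> y \<in> lattice3 \<Longrightarrow> x - y \<in> lattice3"
  and lattice3_uminus: "x \<in> lattice3 \<Longrightarrow> - x \<in> lattice3"
  and lattice3_scaleR: "c \<in> \<int> \<Longrightarrow> x \<in> lattice3 \<Longrightarrow> c *\<^sub>R x \<in> lattice3"
  and lattice3_inner: "x \<in> lattice3 \<Longrightarrow> y \<in> lattice3 \<Longrightarrow> x \<bullet> y \<in> \<int>"
  and lattice3_cross3: "x \<in> lattice3 \<Longrightarrow> y \<in> lattice3 \<Longrightarrow> cross3 x y \<in> lattice3"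
  by (simp_all add: lattice3_iff inner_vec_def sum_3 cross3_def)

lemma finite_lattice3_Int:
  assumes "bounded S"
  shows "finite (S \<inter> lattice3)"
proof -
  obtain R where R: "\<And>x. x \<in> S \<Longrightarrow> norm x \<le> R"
    using assms bounded_iff by blast
  define A where "A = (of_int ` {-\<lceil>R\<rceil>..\<lceil>R\<rceil>} :: real set)"
  have "S \<inter> lattice3 \<subseteq> (\<lambda>(a, b, c). vector [a, b, c]) ` (A \<times> A \<times> A)"
  proof
    fix x assume x: "x \<in> S \<inter> lattice3"
    have "x$i \<in> A" for i
    proof -
      obtain z where z: "x$i = of_int z" using x unfolding lattice3_def by (auto elim: Ints_cases)
      have "\<bar>x$i\<bar> \<le> R" using R[of x] x component_le_norm_cart[of x i] by auto
      then have "\<bar>z\<bar> \<le> \<lceil>R\<rceil>" using z by linarith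
      then show ?thesis using z unfolding A_def by (intro image_eqI[of _ _ z]) auto
    qed
    moreover have "x = vector [x$1, x$2, x$3]"
      by (simp add: vec_eq_iff forall_3)
    ultimately show "x \<in> (\<lambda>(a, b, c). vector [a, b, c]) ` (A \<times> A \<times> A)"
      by (auto intro!: image_eqI[where x="(x$1, x$2, x$3)"])
  qed
  then show ?thesis unfolding A_def by (meson finite_SigmaI finite_imageI finite_subset finite_atLeastAtMost_int)
qed

lemma lattice_values_multiples_of_least:
  fixes n :: "real^3"
  assumes int: "\<And>x. x \<in> lattice3 \<Longrightarrow> n \<bullet> x \<in> \<int>" and e: "e \<in> lattice3" "n \<bullet> e > 0"
  obtains m0 where "m0 \<in> lattice3" "n \<bullet> m0 > 0"
    "\<And>x. x \<in> lattice3 \<Longrightarrow> \<exists>j::int. n \<bullet> x = of_int j * (n \<bullet> m0)"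
proof -
  define S where "S = {t::nat. 0 < t \<and> (\<exists>m\<in>lattice3. n \<bullet> m = real t)}"
  define t0 where "t0 = (LEAST t. t \<in> S)"
  obtain c :: int where "n \<bullet> e = of_int c" using int[OF e(1)] by (auto elim: Ints_cases)
  then have "nat c \<in> S" unfolding S_def using e by (auto intro!: bexI[of _ e])
  then have "t0 \<in> S" unfolding t0_def by (rule LeastI)
  then obtain m0 where m0: "m0 \<in> lattice3" "n \<bullet> m0 = real t0" "t0 > 0"
    unfolding S_def by auto
  have "\<exists>j::int. n \<bullet> x = of_int j * (n \<bullet> m0)" if x: "x \<in> lattice3" for x
  proof -
    obtain z where z: "n \<bullet> x = of_int z" using int[OF x] by (auto elim: Ints_cases)
    define r where "r = z mod int t0"
    have r: "0 \<le> r" "r < int t0" unfolding r_def using m0(3) by auto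
    have "x - of_int (z div int t0) *\<^sub>R m0 \<in> lattice3"
      using x m0(1) by (intro lattice3_diff lattice3_scaleR) auto
    moreover have "n \<bullet> (x - of_int (z div int t0) *\<^sub>R m0) = of_int r"
    proof -
      have "real_of_int z = real_of_int (z div int t0 * int t0 + r)" unfolding r_def by simp
      then show ?thesis using z m0(2) by (simp add: inner_diff_right)
    qed
    ultimately have "r \<noteq> 0 \<Longrightarrow> nat r \<in> S" unfolding S_def using r by auto
    then have "r = 0" using r not_less_Least[of "nat r" "\<lambda>t. t \<in> S"] unfolding t0_def by linarith
    then have "z = z div int t0 * int t0" using div_mult_mod_eq[of z "int t0"] unfolding r_def by linarith
    then have "real_of_int z = real_of_int (z div int t0 * int t0)" by (rule arg_cong)
    then show ?thesis using z m0(2) by (intro exI[of _ "z div int t0"]) simp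
  qed
  then show ?thesis using that m0 by auto
qed

text \<open>\<open>a, b\<close> is a basis of the rank-two lattice \<open>N \<inter> span {a, b}\<close>.\<close>

definition lattice_plane_basis :: "real^3 \<Rightarrow> real^3 \<Rightarrow> bool" where
  "lattice_plane_basis a b \<longleftrightarrow> a \<in> lattice3 \<and> b \<in> lattice3 \<and>
     (\<forall>s t. s *\<^sub>R a + t *\<^sub>R b = 0 \<longrightarrow> s = 0 \<and> t = 0) \<and>
     (\<forall>s t. s *\<^sub>R a + t *\<^sub>R b \<in> lattice3 \<longrightarrow> s \<in> \<int> \<and> t \<in> \<int>)"

lemma lattice_plane_basisD:
  assumes "lattice_plane_basis a b"
  shows "a \<in> lattice3" "b \<in> lattice3"
    and "\<And>s t. s *\<^sub>R a + t *\<^sub>R b = 0 \<Longrightarrow> s = 0 \<and> t = 0"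
    and "\<And>s t. s *\<^sub>R a + t *\<^sub>R b \<in> lattice3 \<Longrightarrow> s \<in> \<int> \<and> t \<in> \<int>"
  using assms unfolding lattice_plane_basis_def by blast+

lemma lattice_plane_basis_rotate:
  assumes ab: "lattice_plane_basis a b"
  shows "lattice_plane_basis b (-a-b)"
proof -
  note basis = lattice_plane_basisD[OF ab]
  have rot: "s *\<^sub>R b + t *\<^sub>R (-a-b) = (-t) *\<^sub>R a + (s - t) *\<^sub>R b" for s t
    by (simp add: algebra_simps)
  have "s \<in> \<int> \<and> t \<in> \<int>" if "s *\<^sub>R b + t *\<^sub>R (-a-b) \<in> lattice3" for s t
  proof -
    have "-t \<in> \<int>" "s - t \<in> \<int>" using basis(4) that unfolding rot by blast+
    then show ?thesis by (metis Ints_minus Ints_add minus_minus diff_add_cancel)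
  qed
  moreover have "s = 0 \<and> t = 0" if "s *\<^sub>R b + t *\<^sub>R (-a-b) = 0" for s t
    using basis(3)[of "-t" "s - t"] that unfolding rot by simp
  ultimately show ?thesis
    unfolding lattice_plane_basis_def using basis(1,2) by (blast intro: lattice3_diff lattice3_uminus)
qed

lemma lattice_plane_basis_rotate_to:
  assumes ab: "lattice_plane_basis a b" and d: "d \<in> {a, b, -a-b}"
  obtains q where "lattice_plane_basis d q" "{d, q, -d-q} = {a, b, -a-b}" "span {d, q} = span {a, b}"
proof -
  have "-b-(-a-b) = a" by simp
  then have bc: "lattice_plane_basis b (-a-b)" "lattice_plane_basis (-a-b) a"
    using lattice_plane_basis_rotate[OF ab] lattice_plane_basis_rotate[OF lattice_plane_basis_rotate[OF ab]]
    by auto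
  have "span {b, -a-b} = span {a, b}" "span {-a-b, a} = span {a, b}"
    using span_rotate[of b a] span_rotate[of "-a-b" b] \<open>-b-(-a-b) = a\<close> by auto
  with d ab bc that show ?thesis by (auto simp: insert_commute)
qed

lemma lattice_iso_onto_span:
  fixes f :: "real^2 \<Rightarrow> real^3"
  assumes L: "subspace L" "dim L = 2" and iso: "lattice_iso_onto f L"
  shows "L = span {f (vector [1, 0]), f (vector [0, 1])}"
proof -
  have lin: "linear f" and inj: "inj f" and img: "f ` lattice2 = lattice3 \<inter> L"
    using iso unfolding lattice_iso_onto_def by auto
  have "dim (range f) = dim (UNIV :: (real^2) set)"
    using lin inj by (intro dim_image_eq) (auto simp: inj_on_def dest: injD)
  moreover have "range f \<subseteq> L"
  proof
    fix y assume "y \<in> range f"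
    then obtain x where "y = f x" by blast
    have "(vector [1, 0] :: real^2) \<in> lattice2" "(vector [0, 1] :: real^2) \<in> lattice2"
      unfolding lattice2_def by (auto simp: forall_2)
    then have "f (vector [1, 0]) \<in> L" "f (vector [0, 1]) \<in> L" using img by blast+
    then show "y \<in> L"
      unfolding \<open>y = f x\<close> linear_coords2[OF lin, of x] using L(1) by (intro subspace_add subspace_scale)
  qed
  ultimately have "range f = L"
    using L lin by (intro subspace_dim_equal) (auto simp: linear_subspace_image)
  moreover have "range f = span {f (vector [1, 0]), f (vector [0, 1])}"
    unfolding span_pair set_eq_iff image_iff by (metis UNIV_I linear_coords2[OF lin] vector_2)
  ultimately show ?thesis by simp
qed

lemma lattice_iso_onto_basis:
  fixes f :: "real^2 \<Rightarrow> real^3"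
  assumes L: "subspace L" "dim L = 2" and iso: "lattice_iso_onto f L"
  shows "lattice_plane_basis (f (vector [1, 0])) (f (vector [0, 1]))"
proof -
  define a b where "a = f (vector [1, 0])" and "b = f (vector [0, 1])"
  have lin: "linear f" and inj: "inj f" and img: "f ` lattice2 = lattice3 \<inter> L"
    using iso unfolding lattice_iso_onto_def by auto
  have coords: "f x = (x$1) *\<^sub>R a + (x$2) *\<^sub>R b" for x
    unfolding a_def b_def by (rule linear_coords2[OF lin])
  have "(vector [1, 0] :: real^2) \<in> lattice2" "(vector [0, 1] :: real^2) \<in> lattice2"
    unfolding lattice2_def by (auto simp: forall_2)
  then have "a \<in> lattice3" "b \<in> lattice3" using img unfolding a_def b_def by blast+
  moreover have indep: "s = 0 \<and> t = 0" if "s *\<^sub>R a + t *\<^sub>R b = 0" for s t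
  proof -
    have "f (vector [s, t]) = f 0" using that coords linear_0[OF lin] by simp
    then have "(vector [s, t] :: real^2) = 0" using inj by (meson injD)
    then show ?thesis by (simp add: vec_eq_iff forall_2)
  qed
  moreover have "s \<in> \<int> \<and> t \<in> \<int>" if "s *\<^sub>R a + t *\<^sub>R b \<in> lattice3" for s t
  proof -
    have "s *\<^sub>R a + t *\<^sub>R b \<in> L"
      using lattice_iso_onto_span[OF L iso] span_pair unfolding a_def b_def by blast
    then have "s *\<^sub>R a + t *\<^sub>R b \<in> f ` lattice2" using img that by blast
    then obtain w where w: "w \<in> lattice2" "f w = s *\<^sub>R a + t *\<^sub>R b" by auto
    have "(s - w$1) *\<^sub>R a + (t - w$2) *\<^sub>R b = (s *\<^sub>R a + t *\<^sub>R b) - f w"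
      unfolding coords[of w] by (simp add: algebra_simps)
    then have "s = w$1" "t = w$2"
      using indep[of "s - w$1" "t - w$2"] w(2) by auto
    then show ?thesis using w(1) unfolding lattice2_def by auto
  qed
  ultimately show ?thesis unfolding lattice_plane_basis_def a_def b_def by blast
qed

lemma integral_normal:
  fixes p q e :: "real^3"
  assumes pq: "lattice_plane_basis p q" and e: "e \<notin> span {p, q}"
  obtains n where "n \<bullet> p = 0" "n \<bullet> q = 0" "0 < n \<bullet> e" "\<And>y. y \<in> lattice3 \<Longrightarrow> n \<bullet> y \<in> \<int>"
proof -
  note basis = lattice_plane_basisD[OF pq]
  define c where "c = cross3 p q"
  have c: "c \<bullet> p = 0" "c \<bullet> q = 0" unfolding c_def by (simp_all add: dot_cross_self)
  have "c \<bullet> e \<noteq> 0"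
    using e cross3_eq_0_iff_in_span[of p q e, OF basis(3)] unfolding c_def by blast
  moreover have "c \<bullet> y \<in> \<int>" "(- c) \<bullet> y \<in> \<int>" if "y \<in> lattice3" for y
    unfolding c_def using that basis(1,2) by (auto intro: lattice3_inner lattice3_cross3)
  ultimately show ?thesis
    using that[of c] that[of "- c"] c by (cases "c \<bullet> e > 0") auto
qed

lemma exists_residue_in_interval:
  fixes k lo i :: int
  assumes "k > 0"
  obtains u where "lo \<le> u" "u \<le> lo + k - 1" "k dvd (u - i)"
proof
  show "lo \<le> lo + (i - lo) mod k" "lo + (i - lo) mod k \<le> lo + k - 1"
    using pos_mod_sign[OF assms, of "i - lo"] pos_mod_bound[OF assms, of "i - lo"] by linarith+
  have "k dvd ((i - lo) mod k - (i - lo))"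
    by (simp add: mod_eq_dvd_iff[symmetric])
  then show "k dvd (lo + (i - lo) mod k - i)"
    by (simp add: algebra_simps)
qed

text \<open>The four inequalities cut out \<open>k - 1\<close> times the lattice quadrangle with vertices
  \<open>(1, 0), (0, 1), (-1, 0), (-1, -1)\<close>, cf. \<open>mem_convex_hull_quadrangle\<close>.\<close>

lemma residues_in_quadrangle:
  fixes k i j :: int
  assumes k: "k \<ge> 2"
  obtains u v where "k dvd (u - i)" "k dvd (v - j)"
    "u + v \<le> k - 1" "v - u \<le> k - 1" "- (k - 1) \<le> u" "u - 2 * v \<le> k - 1"
proof -
  obtain v0 where v0: "0 \<le> v0" "v0 \<le> k - 1" "k dvd (v0 - j)"
    using exists_residue_in_interval[of k 0 j] k by auto
  show ?thesis
  proof (cases "2 * v0 \<le> k - 1")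
    case True
    obtain u where u: "v0 - k + 1 \<le> u" "u \<le> v0" "k dvd (u - i)"
      using exists_residue_in_interval[of k "v0 - k + 1" i] k by auto
    have "u + v0 \<le> k - 1" "v0 - u \<le> k - 1" "- (k - 1) \<le> u" "u - 2 * v0 \<le> k - 1"
      using True u v0 by linarith+
    with u(3) v0(3) show ?thesis by (rule that)
  next
    case False
    obtain u where u: "- (k - 1) \<le> u" "u \<le> 0" "k dvd (u - i)"
      using exists_residue_in_interval[of k "- (k - 1)" i] k by auto
    show ?thesis
    proof (cases "u = 0")
      case True
      have "u + v0 \<le> k - 1" "v0 - u \<le> k - 1" "u - 2 * v0 \<le> k - 1"
        using True v0 k by linarith+
      with u v0(3) show ?thesis by (intro that) auto
    next
      case u0: False
      have "k dvd (v0 - k - j)" using dvd_diff[OF v0(3) dvd_refl[of k]] by (simp add: algebra_simps)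
      moreover have "u + (v0 - k) \<le> k - 1" "(v0 - k) - u \<le> k - 1" "u - 2 * (v0 - k) \<le> k - 1"
        using u u0 v0 False by auto
      ultimately show ?thesis using u by (intro that) auto
    qed
  qed
qed

lemma scaleR_eq_convex_combination:
  fixes m e p q :: "'a::real_vector"
  assumes "K > 1" "K *\<^sub>R m = e + u *\<^sub>R p + v *\<^sub>R q"
  shows "m = (1 / K) *\<^sub>R e + (1 - 1 / K) *\<^sub>R ((u / (K - 1)) *\<^sub>R p + (v / (K - 1)) *\<^sub>R q)"
proof -
  have coeff: "(1 - 1 / K) * (x / (K - 1)) = x / K" for x
    using assms(1) by (simp add: field_simps)
  have "m = (1 / K) *\<^sub>R (K *\<^sub>R m)" using assms(1) by simp
  also have "\<dots> = (1 / K) *\<^sub>R e + ((u / K) *\<^sub>R p + (v / K) *\<^sub>R q)"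
    unfolding assms(2) by (simp add: scaleR_add_right)
  also have "(u / K) *\<^sub>R p + (v / K) *\<^sub>R q = (1 - 1 / K) *\<^sub>R ((u / (K - 1)) *\<^sub>R p + (v / (K - 1)) *\<^sub>R q)"
    unfolding scaleR_add_right scaleR_scaleR coeff ..
  finally show ?thesis .
qed

lemma lattice_point_in_pyramid_slice:
  fixes p q e m0 :: "real^3" and k :: int
  assumes pq: "lattice_plane_basis p q" and e: "e \<in> lattice3" and m0: "m0 \<in> lattice3"
    and k: "k \<ge> 2" and plane: "of_int k *\<^sub>R m0 - e \<in> span {p, q}"
  obtains m w where "m \<in> lattice3" "w \<in> convex hull {p, q, -p, -p-q}"
    "m = (1 / of_int k) *\<^sub>R e + (1 - 1 / of_int k) *\<^sub>R w"
proof -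
  note basis = lattice_plane_basisD[OF pq]
  obtain i0 j0 where ij0: "of_int k *\<^sub>R m0 - e = i0 *\<^sub>R p + j0 *\<^sub>R q"
    using plane unfolding span_pair by blast
  moreover have "of_int k *\<^sub>R m0 - e \<in> lattice3"
    using m0 e by (intro lattice3_diff lattice3_scaleR) auto
  ultimately have "i0 \<in> \<int>" "j0 \<in> \<int>" using basis(4) by auto
  then obtain i j :: int where ij: "i0 = of_int i" "j0 = of_int j" by (auto elim!: Ints_cases)
  obtain u v where uv: "k dvd (u - i)" "k dvd (v - j)"
    "u + v \<le> k - 1" "v - u \<le> k - 1" "- (k - 1) \<le> u" "u - 2 * v \<le> k - 1"
    using residues_in_quadrangle[OF k] by blast
  obtain s t where "u - i = k * s" "v - j = k * t" using uv(1,2) by (elim dvdE)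
  then have st: "u = i + k * s" "v = j + k * t" by linarith+
  define m where "m = m0 + of_int s *\<^sub>R p + of_int t *\<^sub>R q"
  define K where "K = real_of_int k"
  define w where "w = (of_int u / (K - 1)) *\<^sub>R p + (of_int v / (K - 1)) *\<^sub>R q"
  have K: "K \<ge> 2" unfolding K_def using k by simp
  have "m \<in> lattice3" unfolding m_def using m0 basis(1,2) by (intro lattice3_add lattice3_scaleR) auto
  moreover have "w \<in> convex hull {p, q, -p, -p-q}"
  proof -
    have K1: "K - 1 > 0" using K by simp
    have "of_int (u + v) / (K - 1) \<le> 1" "of_int (v - u) / (K - 1) \<le> 1" "- 1 \<le> of_int u / (K - 1)"
      "of_int (u - 2 * v) / (K - 1) \<le> 1"
      using uv(3-6) unfolding pos_divide_le_eq[OF K1] pos_le_divide_eq[OF K1] by (simp_all add: K_def)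
    then show ?thesis unfolding w_def
      by (intro mem_convex_hull_quadrangle) (simp_all add: add_divide_distrib diff_divide_distrib)
  qed
  moreover have "K *\<^sub>R m = e + of_int u *\<^sub>R p + of_int v *\<^sub>R q"
  proof -
    have "K *\<^sub>R m = (of_int k *\<^sub>R m0 - e) + e + (K * of_int s) *\<^sub>R p + (K * of_int t) *\<^sub>R q"
      unfolding m_def K_def by (simp add: algebra_simps)
    also have "\<dots> = e + of_int (i + k * s) *\<^sub>R p + of_int (j + k * t) *\<^sub>R q"
      unfolding ij0 ij K_def by (simp add: algebra_simps)
    finally show ?thesis unfolding st .
  qed
  then have "m = (1 / K) *\<^sub>R e + (1 - 1 / K) *\<^sub>R w"
    unfolding w_def using K by (intro scaleR_eq_convex_combination) auto
  ultimately show ?thesis unfolding K_def by (rule that)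
qed

section \<open>Unimodular matrices\<close>

lemma matrix_columns_mult:
  fixes u v w :: "real^3"
  shows "(\<chi> i. vector [u$i, v$i, w$i] :: real^3^3) *v y = y$1 *\<^sub>R u + y$2 *\<^sub>R v + y$3 *\<^sub>R w"
  by (simp add: vec_eq_iff matrix_vector_mult_def sum_3 algebra_simps)

lemma det_integral:
  fixes M :: "real^3^3"
  assumes "\<And>i j. M$i$j \<in> \<int>"
  shows "det M \<in> \<int>"
  unfolding det_3 using assms by (intro Ints_add Ints_diff Ints_mult) auto

lemma GL3Z_if_integral_inverse:
  fixes A B :: "real^3^3"
  assumes "\<And>i j. A$i$j \<in> \<int>" "\<And>i j. B$i$j \<in> \<int>" and AB: "A ** B = mat 1"
  shows "A \<in> GL3Z"
proof -
  obtain a b where "det A = of_int a" "det B = of_int b"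
    using det_integral[of A] det_integral[of B] assms(1,2) by (metis Ints_cases)
  moreover have "det A * det B = 1" using AB by (metis det_I det_mul)
  ultimately have "a * b = 1" by (metis of_int_eq_1_iff of_int_mult)
  then have "\<bar>det A\<bar> = 1" using \<open>det A = of_int a\<close> by (auto simp: zmult_eq_1_iff)
  then show ?thesis unfolding GL3Z_def using assms(1) by auto
qed

lemma GL3Z_to_standard_basis:
  fixes u v w :: "real^3"
  assumes lat: "u \<in> lattice3" "v \<in> lattice3" "w \<in> lattice3"
    and basis: "\<And>x. x \<in> lattice3 \<Longrightarrow> \<exists>i j l. i \<in> \<int> \<and> j \<in> \<int> \<and> l \<in> \<int> \<and> x = i *\<^sub>R u + j *\<^sub>R v + l *\<^sub>R w"
  shows "\<exists>A\<in>GL3Z. A *v u = vector [1,0,0] \<and> A *v v = vector [0,1,0] \<and> A *v w = vector [0,0,1]"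
proof -
  have "\<exists>c::real^3. (\<forall>i. c$i \<in> \<int>) \<and> axis j 1 = c$1 *\<^sub>R u + c$2 *\<^sub>R v + c$3 *\<^sub>R w" for j :: 3
  proof -
    have "axis j (1::real) \<in> lattice3" unfolding lattice3_def by (auto simp: axis_def)
    then obtain i k l where "i \<in> \<int>" "k \<in> \<int>" "l \<in> \<int>" "axis j 1 = i *\<^sub>R u + k *\<^sub>R v + l *\<^sub>R w"
      using basis by blast
    then show ?thesis by (intro exI[of _ "vector [i, k, l]"]) (auto simp: forall_3)
  qed
  then obtain c :: "3 \<Rightarrow> real^3"
    where c: "\<And>j i. c j $ i \<in> \<int>" "\<And>j. axis j 1 = (c j)$1 *\<^sub>R u + (c j)$2 *\<^sub>R v + (c j)$3 *\<^sub>R w"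
    by metis
  define A :: "real^3^3" where "A = (\<chi> i. vector [(c 1)$i, (c 2)$i, (c 3)$i])"
  define B :: "real^3^3" where "B = (\<chi> i. vector [u$i, v$i, w$i])"
  have Bc: "B *v c j = axis j 1" for j unfolding B_def matrix_columns_mult c(2) ..
  have "B ** A = mat 1"
  proof -
    have "(B ** A) *v x = x" for x
    proof -
      have "(B ** A) *v x = x$1 *\<^sub>R (B *v c 1) + x$2 *\<^sub>R (B *v c 2) + x$3 *\<^sub>R (B *v c 3)"
        unfolding matrix_vector_mul_assoc[symmetric] A_def matrix_columns_mult
        by (simp add: matrix_vector_right_distrib matrix_vector_mult_scaleR)
      also have "\<dots> = x" unfolding Bc by (simp add: vec_eq_iff forall_3 axis_def)
      finally show ?thesis .
    qed
    then show ?thesis by (simp add: matrix_eq)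
  qed
  then have AB: "A ** B = mat 1" by (simp add: matrix_left_right_inverse)
  have "u = B *v axis 1 1" "v = B *v axis 2 1" "w = B *v axis 3 1"
    unfolding B_def matrix_columns_mult by (simp_all add: axis_def)
  then have "A *v u = axis 1 1" "A *v v = axis 2 1" "A *v w = axis 3 1"
    by (metis AB matrix_vector_mul_assoc matrix_vector_mul_lid)+
  moreover have "A \<in> GL3Z"
  proof (rule GL3Z_if_integral_inverse[OF _ _ AB])
    show "A$i$j \<in> \<int>" for i j
      unfolding A_def using c(1) exhaust_3[of j] by auto
    show "B$i$j \<in> \<int>" for i j
      unfolding B_def using lat exhaust_3[of j] by (auto simp: lattice3_def)
  qed
  moreover have "axis 1 1 = (vector [1,0,0] :: real^3)" "axis 2 1 = (vector [0,1,0] :: real^3)"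
    "axis 3 1 = (vector [0,0,1] :: real^3)"
    by (simp_all add: vec_eq_iff forall_3 axis_def)
  ultimately show ?thesis by auto
qed

lemma linear_image_of_normal_form:
  fixes A :: "real^3^3" and p q e :: "real^3"
  assumes "A *v p = vector [1,0,0]" "A *v e = vector [0,1,0]" "A *v q = vector [0,0,1]"
  shows "(\<lambda>x. A *v x) ` (convex hull {p, q, -p-q, e, -(2 *\<^sub>R p) - e})
    = convex hull {vector [1,0,0], vector [0,1,0], vector [0,0,1], vector [-2,-1,0], vector [-1,0,-1]}"
proof -
  have lin: "linear ((*v) A)" by (rule matrix_vector_mul_linear)
  have "A *v (-p-q) = vector [-1,0,-1]" "A *v (-(2 *\<^sub>R p) - e) = vector [-2,-1,0]"
    using assms by (simp_all add: linear_diff[OF lin] linear_neg[OF lin] linear_scale[OF lin]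
        vec_eq_iff forall_3)
  then have "(*v) A ` {p, q, -p-q, e, -(2 *\<^sub>R p) - e}
      = {vector [1,0,0], vector [0,1,0], vector [0,0,1], vector [-2,-1,0], vector [-1,0,-1]}"
    using assms by auto
  then show ?thesis using convex_hull_linear_image[OF lin] by metis
qed

section \<open>Minimal Fano polytopes\<close>

lemma vertices_subset: "vertices P \<subseteq> P"
  unfolding vertices_def extreme_point_of_def by auto

lemma minimal_fano_interior_needs_vertex:
  assumes mf: "minimal_fano P" and \<rho>: "\<rho> \<in> vertices P"
    and X: "X \<subseteq> P \<inter> lattice3" "\<rho> \<notin> X"
  shows "0 \<notin> interior (convex hull X)"
proof
  assume int0: "0 \<in> interior (convex hull X)"
  define V where "V = (P \<inter> lattice3) - {\<rho>}"
  obtain W where W: "finite W" "P = convex hull W"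
    and intP: "interior P \<inter> lattice3 = {0}"
    using mf unfolding minimal_fano_def fano_polytope_def by auto
  have "finite V"
    unfolding V_def using finite_lattice3_Int[of P] W by (simp add: finite_imp_bounded_convex_hull)
  have "convex hull V \<subseteq> P"
    unfolding V_def W(2) by (intro hull_minimal) auto
  then have "interior (convex hull V) \<subseteq> interior P" by (rule interior_mono)
  moreover have "interior (convex hull X) \<subseteq> interior (convex hull V)"
    using X unfolding V_def by (intro interior_mono hull_mono) auto
  ultimately have "interior (convex hull V) \<inter> lattice3 = {0}" using int0 intP by auto
  then have "fano_polytope (convex hull V)"
    unfolding fano_polytope_def using \<open>finite V\<close> V_def by blast
  moreover have "\<not> fano_polytope (convex hull V)"
    using mf \<rho> unfolding minimal_fano_def V_def by simp
  ultimately show False by contradiction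
qed

lemma lattice_basis_from_height_one:
  fixes p q e n :: "real^3"
  assumes pq: "lattice_plane_basis p q" and e: "e \<in> lattice3"
    and n: "n \<bullet> p = 0" "n \<bullet> q = 0" "0 < n \<bullet> e"
    and height: "\<And>y. y \<in> lattice3 \<Longrightarrow> \<exists>j::int. n \<bullet> y = of_int j * (n \<bullet> e)"
    and x: "x \<in> lattice3"
  shows "\<exists>i j l. i \<in> \<int> \<and> j \<in> \<int> \<and> l \<in> \<int> \<and> x = i *\<^sub>R p + j *\<^sub>R e + l *\<^sub>R q"
proof -
  note basis = lattice_plane_basisD[OF pq]
  obtain j where j: "n \<bullet> x = of_int j * (n \<bullet> e)" using height[OF x] by blast
  have hyper: "{y. n \<bullet> y = 0} = span {p, q}"
    using hyperplane_eq_span_pair[of p q n, OF basis(3)] n by fastforce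
  have "x - of_int j *\<^sub>R e \<in> span {p, q}"
    unfolding hyper[symmetric] using j by (simp add: inner_diff_right)
  then obtain i l where il: "x - of_int j *\<^sub>R e = i *\<^sub>R p + l *\<^sub>R q" unfolding span_pair by blast
  moreover have "x - of_int j *\<^sub>R e \<in> lattice3"
    using x e by (intro lattice3_diff lattice3_scaleR) auto
  ultimately have "i \<in> \<int>" "l \<in> \<int>" using basis(4) by auto
  moreover have "x = i *\<^sub>R p + of_int j *\<^sub>R e + l *\<^sub>R q" using il by (simp add: algebra_simps)
  ultimately show ?thesis by (intro exI[of _ i] exI[of _ "of_int j"] exI[of _ l]) auto
qed

text \<open>Together with the triangle and with \<open>-2p-e\<close>, which lies below the plane, such a point \<open>m\<close>
  puts the origin into the interior without using the vertex \<open>e\<close>.\<close>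

lemma minimal_fano_no_lattice_point_below_vertex:
  fixes p q e n m :: "real^3"
  assumes mf: "minimal_fano P" and e: "e \<in> vertices P"
    and pts: "{p, q, -p-q, -(2 *\<^sub>R p) - e} \<subseteq> P \<inter> lattice3"
    and indep: "\<And>s t. s *\<^sub>R p + t *\<^sub>R q = 0 \<Longrightarrow> s = 0 \<and> t = 0"
    and n: "n \<bullet> p = 0" "n \<bullet> q = 0"
    and m: "m \<in> P \<inter> lattice3" "0 < n \<bullet> m" "n \<bullet> m < n \<bullet> e"
  shows False
proof -
  let ?g = "-(2 *\<^sub>R p) - e"
  have "n \<bullet> ?g < 0" using n m by (simp add: inner_diff_right)
  then have "0 \<in> interior (convex hull {p, q, -(1 *\<^sub>R p) - 1 *\<^sub>R q, ?g, m})"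
    using m(2) n by (intro origin_in_interior_triangle_straddle[OF indep]) auto
  moreover have "n \<bullet> y \<noteq> n \<bullet> e" if "y \<in> {p, q, -p-q, ?g, m}" for y
    using that n m \<open>n \<bullet> ?g < 0\<close> by (auto simp: inner_diff_right)
  then have "e \<notin> {p, q, -p-q, ?g, m}" by blast
  ultimately show False
    using minimal_fano_interior_needs_vertex[OF mf e, of "{p, q, -p-q, ?g, m}"] pts m(1) by auto
qed

lemma minimal_fano_lattice_basis:
  fixes P :: "(real^3) set" and p q e :: "real^3"
  assumes mf: "minimal_fano P"
    and P: "P = convex hull {p, q, -p-q, e, -(2 *\<^sub>R p) - e}"
    and e: "e \<in> vertices P" "e \<in> lattice3" "e \<notin> span {p, q}"
    and pq: "lattice_plane_basis p q" and x: "x \<in> lattice3"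
  shows "\<exists>i j l. i \<in> \<int> \<and> j \<in> \<int> \<and> l \<in> \<int> \<and> x = i *\<^sub>R p + j *\<^sub>R e + l *\<^sub>R q"
proof -
  note basis = lattice_plane_basisD[OF pq]
  obtain n where n: "n \<bullet> p = 0" "n \<bullet> q = 0" "0 < n \<bullet> e" "\<And>y. y \<in> lattice3 \<Longrightarrow> n \<bullet> y \<in> \<int>"
    using integral_normal[OF pq e(3)] by blast
  have "convex P" unfolding P by simp
  have pts: "{p, q, -p-q, e, -(2 *\<^sub>R p) - e} \<subseteq> P \<inter> lattice3"
    using basis(1,2) e(2) unfolding P
    by (auto intro: hull_inc lattice3_diff lattice3_uminus lattice3_scaleR[of 2, simplified])
  have "(1/2) *\<^sub>R e + (1/2) *\<^sub>R (-(2 *\<^sub>R p) - e) \<in> P"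
    using pts by (intro convexD[OF \<open>convex P\<close>]) auto
  then have "- p \<in> P" by (simp add: algebra_simps)
  then have quadrangle: "convex hull {p, q, -p, -p-q} \<subseteq> P"
    using pts \<open>convex P\<close> by (intro hull_minimal) auto
  obtain m0 where m0: "m0 \<in> lattice3" "0 < n \<bullet> m0"
    and multiples: "\<And>y. y \<in> lattice3 \<Longrightarrow> \<exists>j::int. n \<bullet> y = of_int j * (n \<bullet> m0)"
    using lattice_values_multiples_of_least[OF n(4) e(2) n(3)] by blast
  obtain k where k: "n \<bullet> e = of_int k * (n \<bullet> m0)" using multiples[OF e(2)] by blast
  have "k = 1"
  proof (rule ccontr)
    assume "k \<noteq> 1"
    moreover have "k > 0" using k n(3) m0(2) by (simp add: zero_less_mult_iff)
    ultimately have "k \<ge> 2" by simp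
    have hyper: "{y. n \<bullet> y = 0} = span {p, q}"
      using hyperplane_eq_span_pair[of p q n, OF basis(3)] n by fastforce
    have "of_int k *\<^sub>R m0 - e \<in> span {p, q}"
      unfolding hyper[symmetric] using k by (simp add: inner_diff_right)
    with \<open>k \<ge> 2\<close> obtain m w where m: "m \<in> lattice3" "w \<in> convex hull {p, q, -p, -p-q}"
      "m = (1 / of_int k) *\<^sub>R e + (1 - 1 / of_int k) *\<^sub>R w"
      using lattice_point_in_pyramid_slice[OF pq e(2) m0(1)] by blast
    have "convex hull {p, q, -p, -p-q} \<subseteq> span {p, q}"
      by (intro hull_minimal) (auto simp: span_base span_neg span_diff subspace_imp_convex)
    then have "n \<bullet> w = 0" using m(2) hyper by blast
    then have "n \<bullet> m = (n \<bullet> e) / of_int k" unfolding m(3) by (simp add: inner_add_right)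
    moreover have "m \<in> P"
      unfolding m(3) using \<open>k \<ge> 2\<close> m(2) quadrangle pts
      by (intro convexD[OF \<open>convex P\<close>]) (auto simp: field_simps)
    moreover have "1 * (n \<bullet> e) < of_int k * (n \<bullet> e)"
      using n(3) \<open>k \<ge> 2\<close> by (intro mult_strict_right_mono) auto
    ultimately show False
      using minimal_fano_no_lattice_point_below_vertex[OF mf e(1) _ basis(3) n(1,2), of m] pts m(1) n(3)
        \<open>k \<ge> 2\<close> by (simp add: divide_less_eq)
  qed
  show ?thesis
    by (rule lattice_basis_from_height_one[OF pq e(2) n(1-3) _ x]) (use multiples k \<open>k = 1\<close> in auto)
qed

locale minimal_fano_two_triangles =
  fixes P :: "(real^3) set" and a b d e :: "real^3"
  assumes minimal: "minimal_fano P"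
    and basis_ab: "lattice_plane_basis a b" and basis_de: "lattice_plane_basis d e"
    and planes_differ: "span {a, b} \<noteq> span {d, e}"
    and triangle_vertices: "{a, b, -a-b, d, e, -(2 *\<^sub>R d) - e} \<subseteq> vertices P"
begin

lemma triangle_points: "{a, b, -a-b, d, e, -(2 *\<^sub>R d) - e} \<subseteq> P \<inter> lattice3"
proof -
  have "{a, b, -a-b, d, e, -(2 *\<^sub>R d) - e} \<subseteq> lattice3"
    using lattice_plane_basisD(1,2)[OF basis_ab] lattice_plane_basisD(1,2)[OF basis_de]
    by (auto intro!: lattice3_diff lattice3_uminus lattice3_scaleR[of 2, simplified])
  then show ?thesis using triangle_vertices vertices_subset by blast
qed

lemma de_not_in_plane_ab: "\<not> (d \<in> span {a, b} \<and> e \<in> span {a, b})"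
  using span_pair_eq[of d e a b] planes_differ lattice_plane_basisD(3)[OF basis_ab]
    lattice_plane_basisD(3)[OF basis_de] by metis

lemma ab_not_in_plane_de: "\<not> (a \<in> span {d, e} \<and> b \<in> span {d, e})"
  using span_pair_eq[of a b d e] planes_differ lattice_plane_basisD(3)[OF basis_ab]
    lattice_plane_basisD(3)[OF basis_de] by metis

lemma eq_hull_of_triangles: "P = convex hull {a, b, -a-b, d, e, -(2 *\<^sub>R d) - e}"
proof -
  let ?S = "{a, b, -a-b, d, e, -(2 *\<^sub>R d) - e}"
  let ?n = "cross3 a b"
  note indep = lattice_plane_basisD(3)[OF basis_ab]
  have "\<not> (?n \<bullet> d = 0 \<and> ?n \<bullet> e = 0)"
    using de_not_in_plane_ab cross3_eq_0_iff_in_span[of a b, OF indep] by blast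
  obtain y z where yz: "y \<in> {d, e, -(2 *\<^sub>R d) - 1 *\<^sub>R e}" "z \<in> {d, e, -(2 *\<^sub>R d) - 1 *\<^sub>R e}"
    "?n \<bullet> y < 0" "0 < ?n \<bullet> z"
    by (rule straddle_of_negative_combination[of 2 1 ?n d e]) (use \<open>\<not> (?n \<bullet> d = 0 \<and> ?n \<bullet> e = 0)\<close> in auto)
  then have "0 \<in> interior (convex hull {a, b, -(1 *\<^sub>R a) - 1 *\<^sub>R b, y, z})"
    by (intro origin_in_interior_triangle_straddle[OF indep]) (auto simp: dot_cross_self)
  then have "vertices P \<subseteq> ?S"
    using minimal_fano_interior_needs_vertex[OF minimal, of _ "{a, b, -a-b, y, z}"] yz triangle_points
    by auto
  moreover obtain V where "finite V" "P = convex hull V"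
    using minimal unfolding minimal_fano_def fano_polytope_def by auto
  then have "compact P" "convex P" by (auto simp: finite_imp_compact_convex_hull)
  then have "P = convex hull (vertices P)"
    unfolding vertices_def by (rule Krein_Milman_Minkowski)
  ultimately have "P \<subseteq> convex hull ?S" by (metis hull_mono)
  moreover have "convex hull ?S \<subseteq> P"
    using triangle_points \<open>convex P\<close> by (intro hull_minimal) auto
  ultimately show ?thesis by blast
qed

lemma triangles_share_vertex: "{a, b, -a-b} \<inter> {d, e, -(2 *\<^sub>R d) - e} \<noteq> {}"
proof
  assume disjoint: "{a, b, -a-b} \<inter> {d, e, -(2 *\<^sub>R d) - e} = {}"
  let ?n = "cross3 d e"
  note indep = lattice_plane_basisD(3)[OF basis_de]
  have "\<not> (?n \<bullet> a = 0 \<and> ?n \<bullet> b = 0)"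
    using ab_not_in_plane_de cross3_eq_0_iff_in_span[of d e, OF indep] by blast
  obtain y z where yz: "y \<in> {a, b, -(1 *\<^sub>R a) - 1 *\<^sub>R b}" "z \<in> {a, b, -(1 *\<^sub>R a) - 1 *\<^sub>R b}"
    "?n \<bullet> y < 0" "0 < ?n \<bullet> z"
    by (rule straddle_of_negative_combination[of 1 1 ?n a b]) (use \<open>\<not> (?n \<bullet> a = 0 \<and> ?n \<bullet> b = 0)\<close> in auto)
  then have "0 \<in> interior (convex hull {d, e, -(2 *\<^sub>R d) - 1 *\<^sub>R e, y, z})"
    by (intro origin_in_interior_triangle_straddle[OF indep]) (auto simp: dot_cross_self)
  moreover have "a \<noteq> b" "a \<noteq> -a-b" "b \<noteq> -a-b"
    using triangle_vertices_distinct lattice_plane_basisD(3)[OF basis_ab] by metis+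
  then obtain x where "x \<in> {a, b, -a-b}" "x \<notin> {y, z}"
    by blast
  ultimately show False
    using minimal_fano_interior_needs_vertex[OF minimal, of x "{d, e, -(2 *\<^sub>R d) - e, y, z}"]
      disjoint yz triangle_vertices triangle_points by auto
qed

lemma minus_d_mem: "- d \<in> P \<inter> lattice3"
proof -
  have "(1/2) *\<^sub>R e + (1/2) *\<^sub>R (-(2 *\<^sub>R d) - e) \<in> P"
    using triangle_points eq_hull_of_triangles by (intro convexD) (auto intro: hull_inc)
  moreover have "(1/2) *\<^sub>R e + (1/2) *\<^sub>R (-(2 *\<^sub>R d) - e) = - d" by (simp add: algebra_simps)
  ultimately show ?thesis using triangle_points by (auto intro: lattice3_uminus)
qed

lemma vertices_if_d_off_plane:
  assumes "cross3 a b \<bullet> d \<noteq> 0"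
  shows "vertices P \<subseteq> {a, b, -a-b, d, -d}"
proof
  fix v assume v: "v \<in> vertices P"
  note indep = lattice_plane_basisD(3)[OF basis_ab]
  have "0 \<in> interior (convex hull {a, b, -(1 *\<^sub>R a) - 1 *\<^sub>R b, d, -d})"
  proof (cases "cross3 a b \<bullet> d > 0")
    case True
    then show ?thesis
      using origin_in_interior_triangle_straddle[OF indep, where la=1 and mu=1 and n="cross3 a b" and y="-d" and z=d]
      by (auto simp: dot_cross_self insert_commute)
  next
    case False
    then show ?thesis
      using assms origin_in_interior_triangle_straddle[OF indep, where la=1 and mu=1 and n="cross3 a b" and y=d and z="-d"]
      by (auto simp: dot_cross_self)
  qed
  then show "v \<in> {a, b, -a-b, d, -d}"
    using minimal_fano_interior_needs_vertex[OF minimal v, of "{a, b, -a-b, d, -d}"]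
      triangle_points minus_d_mem by auto
qed

lemma d_in_triangle: "d \<in> {a, b, -a-b}"
proof -
  let ?n = "cross3 a b" and ?g = "-(2 *\<^sub>R d) - e"
  have plane: "?n \<bullet> x = 0 \<longleftrightarrow> x \<in> span {a, b}" for x
    by (rule cross3_eq_0_iff_in_span[OF lattice_plane_basisD(3)[OF basis_ab]])
  have triangle: "?n \<bullet> x = 0" if "x \<in> {a, b, -a-b}" for x
    using that by (auto simp: dot_cross_self inner_diff_right)
  have ng: "?n \<bullet> ?g = - 2 * (?n \<bullet> d) - ?n \<bullet> e" by (simp add: inner_diff_right)
  obtain x where x: "x \<in> {a, b, -a-b}" "x \<in> {d, e, ?g}" using triangles_share_vertex by blast
  have "x \<noteq> e"
  proof
    assume "x = e"
    then have "?n \<bullet> e = 0" using triangle x(1) by blast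
    then have "?n \<bullet> d \<noteq> 0" using de_not_in_plane_ab plane by blast
    then have "?n \<bullet> ?g \<noteq> ?n \<bullet> y" if "y \<in> {a, b, -a-b, d, -d}" for y
      using that ng triangle \<open>?n \<bullet> e = 0\<close> by auto
    then have "?g \<notin> {a, b, -a-b, d, -d}" by blast
    moreover have "?g \<in> vertices P" using triangle_vertices by blast
    ultimately show False using vertices_if_d_off_plane[OF \<open>?n \<bullet> d \<noteq> 0\<close>] by blast
  qed
  moreover have "x \<noteq> ?g"
  proof
    assume "x = ?g"
    then have "?n \<bullet> ?g = 0" using triangle x(1) by blast
    then have "?n \<bullet> e = - 2 * (?n \<bullet> d)" using ng by linarith
    moreover have "\<not> (?n \<bullet> d = 0 \<and> ?n \<bullet> e = 0)" using de_not_in_plane_ab plane by blast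
    ultimately have "?n \<bullet> d \<noteq> 0" by linarith
    then have "?n \<bullet> e \<noteq> ?n \<bullet> y" if "y \<in> {a, b, -a-b, d, -d}" for y
      using that \<open>?n \<bullet> e = - 2 * (?n \<bullet> d)\<close> triangle by auto
    then have "e \<notin> {a, b, -a-b, d, -d}" by blast
    moreover have "e \<in> vertices P" using triangle_vertices by blast
    ultimately show False using vertices_if_d_off_plane[OF \<open>?n \<bullet> d \<noteq> 0\<close>] by blast
  qed
  ultimately show ?thesis using x by auto
qed

theorem normal_form:
  "\<exists>A\<in>GL3Z. (\<lambda>x. A *v x) ` P =
     convex hull {vector [1,0,0], vector [0,1,0], vector [0,0,1], vector [-2,-1,0], vector [-1,0,-1]}"
proof -
  obtain q where q: "lattice_plane_basis d q" "{d, q, -d-q} = {a, b, -a-b}" "span {d, q} = span {a, b}"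
    using lattice_plane_basis_rotate_to[OF basis_ab d_in_triangle] by blast
  have "{a, b, -a-b, d, e, -(2 *\<^sub>R d) - e} = {a, b, -a-b} \<union> {e, -(2 *\<^sub>R d) - e}"
    using d_in_triangle by auto
  also have "\<dots> = {d, q, -d-q, e, -(2 *\<^sub>R d) - e}" unfolding q(2)[symmetric] by auto
  finally have P: "P = convex hull {d, q, -d-q, e, -(2 *\<^sub>R d) - e}" using eq_hull_of_triangles by simp
  have "d \<in> span {a, b}" using d_in_triangle by (auto intro: span_base span_neg span_diff)
  then have "e \<notin> span {d, q}" using de_not_in_plane_ab q(3) by blast
  moreover have "e \<in> vertices P" "e \<in> lattice3" using triangle_vertices triangle_points by auto
  ultimately have "\<And>x. x \<in> lattice3 \<Longrightarrow> \<exists>i j l. i \<in> \<int> \<and> j \<in> \<int> \<and> l \<in> \<int> \<and> x = i *\<^sub>R d + j *\<^sub>R e + l *\<^sub>R q"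
    using minimal_fano_lattice_basis[OF minimal P _ _ _ q(1)] by blast
  then obtain A where "A \<in> GL3Z" "A *v d = vector [1,0,0]" "A *v e = vector [0,1,0]" "A *v q = vector [0,0,1]"
    using GL3Z_to_standard_basis[of d e q] lattice_plane_basisD(1,2)[OF q(1)] \<open>e \<in> lattice3\<close> by blast
  then show ?thesis using linear_image_of_normal_form[of A d e q] P by auto
qed

end

theorem lemma4p12:
  fixes P L1 L2 T1 T2 :: "(real^3) set" and f1 f2 :: "real^2 \<Rightarrow> real^3"
  assumes "minimal_fano P"
    and "subspace L1" "dim L1 = 2" "subspace L2" "dim L2 = 2" "L1 \<noteq> L2"
    and "lattice_iso_onto f1 L1" "lattice_iso_onto f2 L2"
    and "T1 = f1 ` (convex hull {vector [1,0], vector [0,1], vector [-1,-1]})"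
    and "T2 = f2 ` (convex hull {vector [1,0], vector [0,1], vector [-2,-1]})"
    and "f1 ` {vector [1,0], vector [0,1], vector [-1,-1]} \<subseteq> vertices P"
    and "f2 ` {vector [1,0], vector [0,1], vector [-2,-1]} \<subseteq> vertices P"
  shows "\<exists>A\<in>GL3Z. (\<lambda>x. A *v x) ` P =
           convex hull {vector [1,0,0], vector [0,1,0], vector [0,0,1],
                        vector [-2,-1,0], vector [-1,0,-1]}"
proof -
  define a b d e where "a = f1 (vector [1,0])" and "b = f1 (vector [0,1])"
    and "d = f2 (vector [1,0])" and "e = f2 (vector [0,1])"
  have "linear f1" "linear f2" using assms(7,8) unfolding lattice_iso_onto_def by auto
  then have "f1 (vector [-1,-1]) = -a-b" "f2 (vector [-2,-1]) = -(2 *\<^sub>R d) - e"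
    using linear_coords2[of f1 "vector [-1,-1]"] linear_coords2[of f2 "vector [-2,-1]"]
    unfolding a_def b_def d_def e_def by simp_all
  then have "{a, b, -a-b, d, e, -(2 *\<^sub>R d) - e} \<subseteq> vertices P"
    using assms(11,12) unfolding a_def b_def d_def e_def by auto
  moreover have "span {a, b} \<noteq> span {d, e}"
    using assms(6) lattice_iso_onto_span[OF assms(2,3,7)] lattice_iso_onto_span[OF assms(4,5,8)]
    unfolding a_def b_def d_def e_def by simp
  moreover have "lattice_plane_basis a b" "lattice_plane_basis d e"
    using lattice_iso_onto_basis[OF assms(2,3,7)] lattice_iso_onto_basis[OF assms(4,5,8)]
    unfolding a_def b_def d_def e_def .
  ultimately have "minimal_fano_two_triangles P a b d e"
    using assms(1) unfolding minimal_fano_two_triangles_def by blast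
  then show ?thesis by (rule minimal_fano_two_triangles.normal_form)
qed

end
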